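(* Every oriented ray with a bounded representing sequence is not ubiquitous.
   Context: An oriented ray is a digraph whose underlying undirected graph is a ray (one-way infinite path) with first vertex the unique vertex of undirected degree $1$. An arc is in-oriented if it points towards the first vertex and out-oriented otherwise. A phase of an oriented ray is a maximal consistently directed path (dipath) contained in it; its length is its number of arcs. For an oriented ray with infinitely many in-oriented and infinitely many out-oriented arcs, its phases can be listed in order from the first vertex, and its representing sequence is the sequence of natural numbers whose $n$-th term is the length of the $n$-th phase. The representing sequence is bounded if there is $b\in\mathbb N$ such that all its terms lie in $\{1,\dots,b\}$, and unbounded otherwise. A digraph $H$ is ubiquitous if every digraph which, for every $k\in\mathbb N$, contains $k$ pairwise vertex-disjoint subdigraphs isomorphic to $H$ also contains infinitely many pairwise vertex-disjoint subdigraphs isomorphic to $H$. *)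

theory Defs
  imports "Graph_Theory.Graph_Theory"
begin

definition underlying_edges :: "'a pair_pre_digraph \<Rightarrow> 'a set set" where
  "underlying_edges H = (\<lambda>(x, y). {x, y}) ` parcs H"

text \<open>\<open>v\<close> lists the vertices of the underlying undirected ray along the ray, so \<open>v 0\<close> is the
  unique vertex of undirected degree 1. There is at most one such \<open>v\<close>.\<close>

definition ray_enumeration :: "'a pair_pre_digraph \<Rightarrow> (nat \<Rightarrow> 'a) \<Rightarrow> bool" where
  "ray_enumeration H v \<longleftrightarrow>
     bij_betw v UNIV (pverts H) \<and> underlying_edges H = range (\<lambda>n. {v n, v (Suc n)})"

text \<open>Asymmetry excludes pairs of opposite arcs, which would be parallel edges of the
  underlying undirected graph.\<close>

definition oriented_ray :: "'a pair_pre_digraph \<Rightarrow> bool" where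
  "oriented_ray H \<longleftrightarrow> pair_wf_digraph H \<and> asym (parcs H) \<and> (\<exists>v. ray_enumeration H v)"

definition in_oriented_arcs :: "'a pair_pre_digraph \<Rightarrow> ('a \<times> 'a) set" where
  "in_oriented_arcs H = {a \<in> parcs H. \<exists>v n. ray_enumeration H v \<and> a = (v (Suc n), v n)}"

definition out_oriented_arcs :: "'a pair_pre_digraph \<Rightarrow> ('a \<times> 'a) set" where
  "out_oriented_arcs H = parcs H - in_oriented_arcs H"

definition dipath :: "('a, 'b) pre_digraph \<Rightarrow> bool" where
  "dipath P \<longleftrightarrow> (\<exists>x p y. pre_digraph.apath P x p y
     \<and> verts P = set (pre_digraph.awalk_verts P x p) \<and> arcs P = set p)"

text \<open>Only finite dipaths are considered. This loses nothing where phases are used: an oriented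
  ray with infinitely many arcs of both orientations contains no infinite dipath.\<close>

definition phases :: "'a pair_pre_digraph \<Rightarrow> ('a, 'a \<times> 'a) pre_digraph set" where
  "phases H = {P. pre_digraph.max_subgraph (with_proj H) dipath P}"

text \<open>\<open>P\<close> lists the phases in the order of their vertices closest to the first vertex of the
  ray. Terms are indexed from 0.\<close>

definition representing_sequence :: "'a pair_pre_digraph \<Rightarrow> (nat \<Rightarrow> nat) \<Rightarrow> bool" where
  "representing_sequence H s \<longleftrightarrow> (\<exists>v P. ray_enumeration H v
     \<and> bij_betw P UNIV (phases H)
     \<and> strict_mono (\<lambda>n. LEAST k. v k \<in> verts (P n))
     \<and> (\<forall>n. s n = card (arcs (P n))))"

definition bounded_sequence :: "(nat \<Rightarrow> nat) \<Rightarrow> bool" where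
  "bounded_sequence s \<longleftrightarrow> (\<exists>b. \<forall>n. s n \<in> {1..b})"

definition disjoint_copies ::
    "'a pair_pre_digraph \<Rightarrow> 'b pair_pre_digraph \<Rightarrow> 'b pair_pre_digraph set \<Rightarrow> bool" where
  "disjoint_copies H D F \<longleftrightarrow>
     (\<forall>K\<in>F. subgraph (with_proj K) (with_proj D) \<and> digraph_iso (with_proj H) (with_proj K))
     \<and> pairwise (\<lambda>K L. disjnt (pverts K) (pverts L)) F"

text \<open>The first argument fixes the vertex type of the host digraphs, since a definition cannot
  quantify over types. For a countable nonempty \<open>H\<close> all infinite types \<open>'b\<close> give the same notion:
  if a host contains \<open>k\<close> disjoint copies for every \<open>k\<close>, then so does the union of countably many
  of these copies, which is a countable digraph.\<close>

definition ubiquitous :: "'b itself \<Rightarrow> 'a pair_pre_digraph \<Rightarrow> bool" where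
  "ubiquitous _ H \<longleftrightarrow> (\<forall>D :: 'b pair_pre_digraph. pair_loopfree_digraph D \<longrightarrow>
     (\<forall>k. \<exists>F. disjoint_copies H D F \<and> finite F \<and> card F = k) \<longrightarrow>
     (\<exists>F. disjoint_copies H D F \<and> infinite F))"

end

theory Submission
  imports Defs
begin

text \<open>Let \<open>b\<close> be the largest phase length that occurs infinitely often in the ray \<open>H\<close>, and
  fix an orientation shared by infinitely many phases of length \<open>b\<close>. The host is a union of
  copies of \<open>H\<close>, arranged in finite levels with at least \<open>k\<close> copies on level \<open>k\<close>. Any two copies on
  different levels share infinitely many vertices (junctions): the end of a phase of length \<open>b\<close>
  with that orientation on the copy of lower level is identified with the start of such a phase
  on the copy of higher level. At a junction one copy has a source and the other one a sink, so a copy of \<open>H\<close> in the host that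
  changes from one to the other prolongs a phase. A phase longer than \<open>b\<close> occurs only finitely often,
  and therefore almost all changes are of two kinds: moving inwards to a position closer to the start,
  or moving outwards to a lower level. Neither can be repeated forever. Hence every copy of
  \<open>H\<close> in the host eventually follows one of the given copies, disjoint copies of \<open>H\<close> follow
  different given copies of the same level, and there are only finitely many of these.\<close>

section \<open>Oriented rays as sequences of orientations\<close>

text \<open>\<open>d n\<close> says that arc \<open>n\<close> is out-oriented. With \<open>d\<close>
  kept apart from the enumeration \<open>v\<close>, all copies of a ray share one
  \<open>d\<close>.\<close>

definition ray_arc :: "(nat \<Rightarrow> bool) \<Rightarrow> (nat \<Rightarrow> 'a) \<Rightarrow> nat \<Rightarrow> 'a \<times> 'a" where
  "ray_arc d v n = (if d n then (v n, v (Suc n)) else (v (Suc n), v n))"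

definition ray_digraph :: "(nat \<Rightarrow> bool) \<Rightarrow> (nat \<Rightarrow> 'a) \<Rightarrow> 'a pair_pre_digraph" where
  "ray_digraph d v = \<lparr>pverts = range v, parcs = range (ray_arc d v)\<rparr>"

lemma ray_digraph_simps [simp]:
  "pverts (ray_digraph d v) = range v"
  "parcs (ray_digraph d v) = range (ray_arc d v)"
  by (simp_all add: ray_digraph_def)

lemma ray_arc_comp: "ray_arc d (f \<circ> v) n = map_prod f f (ray_arc d v n)"
  by (simp add: ray_arc_def)

lemma ray_arc_in_range:
  "fst (ray_arc d v n) \<in> range v" "snd (ray_arc d v n) \<in> range v"
  by (auto simp: ray_arc_def)

lemma wf_ray_digraph: "wf_digraph (with_proj (ray_digraph d v))"
  by unfold_locales (auto simp: ray_arc_in_range)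

lemma inj_ray_arc:
  assumes "inj v"
  shows "inj (ray_arc d v)"
proof (rule injI)
  fix m n assume "ray_arc d v m = ray_arc d v n"
  with assms show "m = n"
    by (auto simp: ray_arc_def inj_eq split: if_splits)
qed

lemma digraph_iso_ray_digraph:
  assumes "inj v" "inj w"
  shows "digraph_iso (with_proj (ray_digraph d v)) (with_proj (ray_digraph d w))"
proof -
  define f where "f = w \<circ> inv v"
  have fv: "f \<circ> v = w" using assms(1) by (auto simp: f_def)
  have inj: "inj_on f (range v)"
    using assms by (auto simp: f_def inj_on_def)
  have arcs: "map_prod f f (ray_arc d v n) = ray_arc d w n" for n
    using ray_arc_comp[of d f v n] fv by simp
  let ?h = "\<lparr>iso_verts = f, iso_arcs = map_prod f f, iso_head = snd, iso_tail = fst\<rparr>"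
  have "inj_on (map_prod f f) (range (ray_arc d v))"
    using arcs inj_ray_arc[OF assms(2), of d] by (auto simp: inj_on_def)
  then have "pre_digraph.digraph_isomorphism (with_proj (ray_digraph d v)) ?h"
    using inj by (auto simp: pre_digraph.digraph_isomorphism_def wf_ray_digraph)
  moreover have "with_proj (ray_digraph d w) = app_iso ?h (with_proj (ray_digraph d v))"
    using fv by (auto simp: app_iso_def with_proj_def ray_digraph_def image_image arcs)
  ultimately show ?thesis by (auto simp: digraph_iso_def)
qed

text \<open>A copy inherits its enumeration through the isomorphism, so it can be studied as an
  injective sequence with the same orientations \<open>d\<close>.\<close>

lemma digraph_iso_ray_digraphD:
  assumes "digraph_iso (with_proj (ray_digraph d v)) (with_proj K)" "inj v"
  obtains w where "inj w" "K = ray_digraph d w"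
proof -
  obtain h where iso: "pre_digraph.digraph_isomorphism (with_proj (ray_digraph d v)) h"
    and K: "with_proj K = app_iso h (with_proj (ray_digraph d v))"
    using assms(1) by (auto simp: digraph_iso_def)
  define w where "w = iso_verts h \<circ> v"
  have sel: "pverts K = iso_verts h ` range v" "parcs K = iso_arcs h ` range (ray_arc d v)"
    "iso_tail h = fst" "iso_head h = snd"
    using K by (auto simp: app_iso_def with_proj_def)
  have "inj_on (iso_verts h) (range v)"
    using iso by (simp add: pre_digraph.digraph_isomorphism_def)
  then have inj: "inj w" using assms(2) by (simp add: w_def comp_inj_on)
  have "iso_arcs h (ray_arc d v n) = ray_arc d w n" for n
    using iso sel unfolding pre_digraph.digraph_isomorphism_def w_def
    by (auto simp: ray_arc_comp intro!: prod_eqI)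
  then have "K = ray_digraph d w"
    using sel by (auto simp: ray_digraph_def w_def image_image intro!: pair_pre_digraph.equality)
  with inj show ?thesis by (rule that)
qed

section \<open>The host digraph\<close>

text \<open>Ray \<open>R i\<close> is a copy of the given oriented ray. At junction \<open>e\<close> the sequence \<open>d\<close> has a run of
  length \<open>b\<close>, from \<open>q e\<close> to \<open>q e + b\<close>, and the vertex at the end of the run on the ray \<open>lo e\<close> is
  identified with the vertex at the start of the run on the ray \<open>hi e\<close>.\<close>

locale junction_host =
  fixes d :: "nat \<Rightarrow> bool" and b N :: nat and c :: bool and q lo hi lev :: "nat \<Rightarrow> nat"
    and J :: "nat \<Rightarrow> bool" and g :: "nat \<times> nat \<Rightarrow> 'a"
  assumes no_run: "N \<le> n \<Longrightarrow> (\<And>j. j \<le> b \<Longrightarrow> d (n + j) = x) \<Longrightarrow> False"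
    and run: "j < b \<Longrightarrow> d (q e + j) = c"
    and N_less_q: "N < q e"
    and q_step: "q e + b < q (Suc e)"
    and lev_less: "J e \<Longrightarrow> lev (lo e) < lev (hi e)"
    and recurrent: "lev i < lev j \<Longrightarrow> \<exists>e\<ge>t. J e \<and> lo e = i \<and> hi e = j"
    and finite_lev: "finite {i. lev i = k}"
    and card_lev: "k \<le> card {i. lev i = k}"
    and inj_g: "inj g"
begin

lemma b_pos: "0 < b"
  using no_run[of N "d N"] by (cases b) auto

lemma q_less: "e < e' \<Longrightarrow> q e + b < q e'"
proof (induction e')
  case (Suc e')
  then show ?case using q_step[of e'] by (cases "e = e'") auto
qed simp

lemma strict_mono_q: "strict_mono q"
  using q_less by (intro strict_monoI) (metis add_lessD1)

lemma q_eq_iff [simp]: "q e = q e' \<longleftrightarrow> e = e'"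
  using strict_mono_q by (simp add: strict_mono_eq)

lemma q_plus_neq [simp]: "q e + b \<noteq> q e'" "q e' \<noteq> q e + b"
  using q_less[of e e'] q_less[of e' e] b_pos by (cases e e' rule: linorder_cases; simp)+

lemma lo_neq_hi [simp]: "J e \<Longrightarrow> lo e \<noteq> hi e" "J e \<Longrightarrow> hi e \<noteq> lo e"
  using lev_less by fastforce+

lemma d_run: "q e \<le> n \<Longrightarrow> n < q e + b \<Longrightarrow> d n = c"
  using run[of "n - q e" e] by simp

text \<open>The run at \<open>q e\<close> is maximal: one more arc would give a run of
  \<open>b + 1\<close> arcs beyond \<open>N\<close>.\<close>

lemma d_after: "d (q e + b) = (\<not> c)"
proof (rule ccontr)
  assume "d (q e + b) \<noteq> (\<not> c)"
  then show False
    using no_run[of "q e" c] N_less_q[of e] run by (metis le_neq_implies_less nless_le)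
qed

lemma d_before: "d (q e - 1) = (\<not> c)"
proof (rule ccontr)
  assume "d (q e - 1) \<noteq> (\<not> c)"
  moreover have "d (q e - 1 + j) = c" if "0 < j" "j \<le> b" for j
    using that N_less_q[of e] by (intro d_run[of e]) auto
  ultimately have "d (q e - 1 + j) = c" if "j \<le> b" for j
    using that by (cases "j = 0") auto
  \<comment> \<open>The strict bound \<open>N < q e\<close> leaves room for the arc before the
    run.\<close>
  moreover have "N \<le> q e - 1" using N_less_q[of e] by simp
  ultimately show False using no_run by blast
qed

text \<open>Canonical representatives for the identified vertices. One replacement suffices:
  \<open>q e\<close> never equals \<open>q e' + b\<close>, so a class has at most two members. Since
  \<open>q\<close> is injective, \<open>inv q\<close> recovers the junction.\<close>

definition rep :: "nat \<Rightarrow> nat \<Rightarrow> nat \<times> nat" where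
  "rep i n = (if \<exists>e. J e \<and> i = lo e \<and> n = q e + b then (hi (inv q (n - b)), n - b) else (i, n))"

definition R :: "nat \<Rightarrow> nat \<Rightarrow> 'a" where
  "R i n = g (rep i n)"

definition junction :: "nat \<Rightarrow> nat \<Rightarrow> bool" where
  "junction i n \<longleftrightarrow> (\<exists>e. J e \<and> (i = lo e \<and> n = q e + b \<or> i = hi e \<and> n = q e))"

lemma rep_lo: "J e \<Longrightarrow> rep (lo e) (q e + b) = (hi e, q e)"
  using strict_mono_imp_inj_on[OF strict_mono_q] by (auto simp: rep_def)

lemma rep_hi: "rep (hi e) (q e) = (hi e, q e)"
  by (auto simp: rep_def)

lemma R_junction: "J e \<Longrightarrow> R (lo e) (q e + b) = R (hi e) (q e)"
  by (simp add: R_def rep_lo rep_hi)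

lemma R_eqE:
  assumes "R i n = R j m"
  obtains (same) "i = j" "n = m"
  | (lo_hi) e where "J e" "i = lo e" "n = q e + b" "j = hi e" "m = q e"
  | (hi_lo) e where "J e" "i = hi e" "n = q e" "j = lo e" "m = q e + b"
proof -
  have eq: "rep i n = rep j m" using assms inj_g by (simp add: R_def inj_eq)
  show ?thesis
  proof (cases "\<exists>e. J e \<and> i = lo e \<and> n = q e + b")
    case True
    then obtain e where e: "J e" "i = lo e" "n = q e + b" by blast
    show ?thesis
    proof (cases "\<exists>e. J e \<and> j = lo e \<and> m = q e + b")
      case True
      then show ?thesis using eq e same by (auto simp: rep_lo)
    next
      case False
      then have "rep j m = (j, m)" unfolding rep_def by (rule if_not_P)
      then show ?thesis using eq e lo_hi by (auto simp: rep_lo)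
    qed
  next
    case False
    then have i: "rep i n = (i, n)" unfolding rep_def by (rule if_not_P)
    show ?thesis
    proof (cases "\<exists>e. J e \<and> j = lo e \<and> m = q e + b")
      case True
      then show ?thesis using eq i hi_lo by (auto simp: rep_lo)
    next
      case False
      then have "rep j m = (j, m)" unfolding rep_def by (rule if_not_P)
      then show ?thesis using eq i same by auto
    qed
  qed
qed

lemma R_eq_nonjunction: "R i n = R j m \<Longrightarrow> \<not> junction i n \<Longrightarrow> j = i \<and> m = n"
  by (erule R_eqE) (auto simp: junction_def)

text \<open>A junction joins two different levels, so copies on one level are disjoint.\<close>

lemma R_eq_same_level: "R i n = R j m \<Longrightarrow> lev i = lev j \<Longrightarrow> j = i \<and> m = n"
  by (erule R_eqE) (auto dest: lev_less)

lemma inj_R: "inj (R i)"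
  by (rule injI) (auto dest: R_eq_same_level)

text \<open>Junctions sit at the ends of the chosen runs, and these runs are separated by
  gaps.\<close>

lemma nonjunction_interior: "q e < n \<Longrightarrow> n < q e + b \<Longrightarrow> \<not> junction i n"
  unfolding junction_def
proof clarify
  fix e' assume "q e < n" "n < q e + b" "i = lo e' \<and> n = q e' + b \<or> i = hi e' \<and> n = q e'"
  then show False
    using q_less[of e e'] q_less[of e' e] by (cases e e' rule: linorder_cases) auto
qed

definition host :: "'a pair_pre_digraph" where
  "host = \<lparr>pverts = (\<Union>i. range (R i)), parcs = (\<Union>i. range (ray_arc d (R i)))\<rparr>"

lemma host_loopfree: "pair_loopfree_digraph host"
proof unfold_locales
  fix e assume "e \<in> parcs host"
  then obtain i n where e: "e = ray_arc d (R i) n" by (auto simp: host_def)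
  show "fst e \<in> pverts host" "snd e \<in> pverts host"
    using ray_arc_in_range[of d "R i" n] by (auto simp: e host_def)
  show "fst e \<noteq> snd e"
    using inj_R[of i] by (auto simp: e ray_arc_def inj_eq)
qed

end

section \<open>Rays in the host\<close>

locale ray_in_host = junction_host +
  fixes p :: "nat \<Rightarrow> 'a"
  assumes inj_p: "inj p"
    and arc_p: "ray_arc d p n \<in> parcs host"
begin

section \<open>Single steps along the given rays\<close>

definition outward :: "nat \<Rightarrow> nat \<Rightarrow> nat \<Rightarrow> bool" where
  "outward n i m \<longleftrightarrow> p n = R i m \<and> p (Suc n) = R i (Suc m) \<and> d n = d m"

definition inward :: "nat \<Rightarrow> nat \<Rightarrow> nat \<Rightarrow> bool" where
  "inward n i m \<longleftrightarrow> p n = R i (Suc m) \<and> p (Suc n) = R i m \<and> d n = (\<not> d m)"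

lemma stepE:
  obtains (outward) i m where "outward n i m" | (inward) i m where "inward n i m"
proof -
  obtain i m where "ray_arc d p n = ray_arc d (R i) m"
    using arc_p[of n] by (auto simp: host_def)
  then have "outward n i m \<or> inward n i m"
    by (auto simp: ray_arc_def outward_def inward_def split: if_splits)
  then show ?thesis using that by blast
qed

lemma p_neq: "p n \<noteq> p (Suc (Suc n))"
  using inj_p by (simp add: inj_eq)

text \<open>Only \<open>R i\<close> passes through such a vertex, and \<open>p\<close> is injective,
  so it cannot turn back. The next three lemmas treat inward travel and the preceding step in the
  same way.\<close>

lemma outward_Suc_nonjunction:
  assumes "outward n i m" "\<not> junction i (Suc m)"
  shows "outward (Suc n) i (Suc m)"
proof (cases rule: stepE[of "Suc n"])
  case (outward i' m')
  then show ?thesis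
    using assms R_eq_nonjunction[of i "Suc m" i' m'] by (simp add: outward_def)
next
  case (inward i' m')
  then show ?thesis
    using assms R_eq_nonjunction[of i "Suc m" i' "Suc m'"] p_neq[of n]
    by (auto simp: outward_def inward_def)
qed

lemma inward_Suc_nonjunction:
  assumes "inward n i (Suc m)" "\<not> junction i (Suc m)"
  shows "inward (Suc n) i m"
proof (cases rule: stepE[of "Suc n"])
  case (outward i' m')
  then show ?thesis
    using assms R_eq_nonjunction[of i "Suc m" i' m'] p_neq[of n]
    by (auto simp: outward_def inward_def)
next
  case (inward i' m')
  then show ?thesis
    using assms R_eq_nonjunction[of i "Suc m" i' "Suc m'"] by (simp add: inward_def)
qed

lemma outward_pred_nonjunction:
  assumes "outward (Suc n) i (Suc m)" "\<not> junction i (Suc m)"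
  shows "outward n i m"
proof (cases rule: stepE[of n])
  case (outward i' m')
  then show ?thesis
    using assms R_eq_nonjunction[of i "Suc m" i' "Suc m'"] by (simp add: outward_def)
next
  case (inward i' m')
  then show ?thesis
    using assms R_eq_nonjunction[of i "Suc m" i' m'] p_neq[of n]
    by (auto simp: outward_def inward_def)
qed

lemma inward_pred_nonjunction:
  assumes "inward (Suc n) i m" "\<not> junction i (Suc m)"
  shows "inward n i (Suc m)"
proof (cases rule: stepE[of n])
  case (outward i' m')
  then show ?thesis
    using assms R_eq_nonjunction[of i "Suc m" i' "Suc m'"] p_neq[of n]
    by (auto simp: outward_def inward_def)
next
  case (inward i' m')
  then show ?thesis
    using assms R_eq_nonjunction[of i "Suc m" i' m'] by (simp add: inward_def)
qed

text \<open>No junction lies strictly inside a run, so a ray entering it must traverse all of it.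
  This lemma and its three variants supply \<open>b\<close> consecutive steps of equal
  orientation.\<close>

lemma outward_from_run_start:
  assumes "outward n i (q e)"
  shows "j < b \<Longrightarrow> outward (n + j) i (q e + j)"
proof (induction j)
  case (Suc j)
  then show ?case
    using outward_Suc_nonjunction[of "n + j" i "q e + j"] nonjunction_interior[of e "Suc (q e + j)" i]
    by simp
qed (use assms in simp)

lemma inward_from_run_end:
  assumes "inward n i (q e + b - 1)"
  shows "j < b \<Longrightarrow> inward (n + j) i (q e + b - 1 - j)"
proof (induction j)
  case (Suc j)
  have "Suc (q e + b - 1 - Suc j) = q e + b - 1 - j" using Suc by simp
  then show ?case
    using Suc inward_Suc_nonjunction[of "n + j" i "q e + b - 1 - Suc j"]
      nonjunction_interior[of e "q e + b - 1 - j" i]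
    by simp
qed (use assms in simp)

text \<open>The traversal is reconstructed backwards; \<open>b \<le> n\<close> keeps the subtraction
  \<open>n - j\<close> exact.\<close>

lemma outward_to_run_end:
  assumes "outward n i (q e + b - 1)" "b \<le> n"
  shows "j < b \<Longrightarrow> outward (n - j) i (q e + b - 1 - j)"
proof (induction j)
  case (Suc j)
  have "Suc (q e + b - 1 - Suc j) = q e + b - 1 - j" "Suc (n - Suc j) = n - j"
    using Suc assms by simp_all
  then show ?case
    using Suc outward_pred_nonjunction[of "n - Suc j" i "q e + b - 1 - Suc j"]
      nonjunction_interior[of e "q e + b - 1 - j" i]
    by simp
qed (use assms in simp)

lemma inward_to_run_start:
  assumes "inward n i (q e)" "b \<le> n"
  shows "j < b \<Longrightarrow> inward (n - j) i (q e + j)"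
proof (induction j)
  case (Suc j)
  have "Suc (n - Suc j) = n - j" using Suc assms by simp
  then show ?case
    using Suc inward_pred_nonjunction[of "n - Suc j" i "q e + j"]
      nonjunction_interior[of e "Suc (q e + j)" i]
    by simp
qed (use assms in simp)

text \<open>Step \<open>n\<close> together with the run would give \<open>b + 1\<close> equal
  orientations from \<open>n\<close> on.\<close>

lemma not_outward_after_opposite_run:
  assumes "outward (Suc n) i (q e)" "N \<le> n" "d n = c"
  shows False
proof (rule no_run[of n c])
  fix j assume "j \<le> b"
  show "d (n + j) = c"
  proof (cases j)
    case 0
    then show ?thesis using assms by simp
  next
    case (Suc j')
    then show ?thesis
      using outward_from_run_start[OF assms(1), of j'] \<open>j \<le> b\<close> run[of j' e]
      by (simp add: outward_def)
  qed
qed (use assms in simp)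

text \<open>Met inwards, a run of orientation \<open>c\<close> contributes \<open>b\<close> steps of
  orientation \<open>\<not> c\<close>.\<close>

lemma not_inward_after_opposite_run:
  assumes "inward (Suc n) i (q e + b - 1)" "N \<le> n" "d n = (\<not> c)"
  shows False
proof (rule no_run[of n "\<not> c"])
  fix j assume "j \<le> b"
  show "d (n + j) = (\<not> c)"
  proof (cases j)
    case 0
    then show ?thesis using assms by simp
  next
    case (Suc j')
    then show ?thesis
      using inward_from_run_end[OF assms(1), of j'] \<open>j \<le> b\<close> run[of "b - 1 - j'" e]
      by (simp add: inward_def)
  qed
qed (use assms in simp)

text \<open>Now the extra step comes after the run, so the forbidden run starts at
  \<open>Suc n - b\<close>; \<open>N + b \<le> n\<close> places it beyond \<open>N\<close>.\<close>

lemma not_continued_after_outward_run: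
  assumes "outward n i (q e + b - 1)" "N + b \<le> n" "d (Suc n) = c"
  shows False
proof (rule no_run[of "Suc n - b" c])
  fix j assume "j \<le> b"
  show "d (Suc n - b + j) = c"
  proof (cases "j = b")
    case True
    then show ?thesis using assms by simp
  next
    case False
    then have "Suc n - b + j = n - (b - 1 - j)" "q e + b - 1 - (b - 1 - j) = q e + j"
      using \<open>j \<le> b\<close> assms by simp_all
    then show ?thesis
      using outward_to_run_end[OF assms(1), of "b - 1 - j"] assms(2) False \<open>j \<le> b\<close> run[of j e]
      by (simp add: outward_def)
  qed
qed (use assms in simp)

lemma not_continued_after_inward_run:
  assumes "inward n i (q e)" "N + b \<le> n" "d (Suc n) = (\<not> c)"
  shows False
proof (rule no_run[of "Suc n - b" "\<not> c"])
  fix j assume "j \<le> b"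
  show "d (Suc n - b + j) = (\<not> c)"
  proof (cases "j = b")
    case True
    then show ?thesis using assms by simp
  next
    case False
    then have "Suc n - b + j = n - (b - 1 - j)"
      using \<open>j \<le> b\<close> assms by simp
    then show ?thesis
      using inward_to_run_start[OF assms(1), of "b - 1 - j"] assms(2) False \<open>j \<le> b\<close>
        run[of "b - 1 - j" e]
      by (simp add: inward_def)
  qed
qed (use assms in simp)

text \<open>Of the possible changes of ray only one survives, outwards from \<open>hi e\<close> to
  \<open>lo e\<close>. Each other change puts a step of equal orientation next to a fully traversed
  run.\<close>

lemma outward_Suc:
  assumes out: "outward n i m" and n: "N + b \<le> n"
  shows "outward (Suc n) i (Suc m) \<or> (\<exists>i' m'. outward (Suc n) i' m' \<and> lev i' < lev i)"
proof (cases rule: stepE[of "Suc n"])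
  case (outward i' m')
  then have "R i (Suc m) = R i' m'" using out by (simp add: outward_def)
  then show ?thesis
  proof (cases rule: R_eqE)
    case same
    then show ?thesis using outward by simp
  next
    case (lo_hi e)
    then have "m = q e + b - 1" by simp
    moreover have "d (Suc n) = c"
      using outward lo_hi run[of 0 e] b_pos by (simp add: outward_def)
    ultimately show ?thesis using not_continued_after_outward_run[of n i e] out n by simp
  next
    case (hi_lo e)
    then show ?thesis using outward lev_less by blast
  qed
next
  case (inward i' m')
  then have "R i (Suc m) = R i' (Suc m')" using out by (simp add: outward_def inward_def)
  then show ?thesis
  proof (cases rule: R_eqE)
    case same
    then show ?thesis using inward out p_neq[of n] by (simp add: outward_def inward_def)
  next
    case (lo_hi e)
    then have "m = q e + b - 1" "m' = q e - 1" by simp_all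
    moreover have "d (Suc n) = c"
      using inward \<open>m' = q e - 1\<close> d_before[of e] by (simp add: inward_def)
    ultimately show ?thesis using not_continued_after_outward_run[of n i e] out n by simp
  next
    case (hi_lo e)
    then have "m' = q e + b - 1" "m = q e - 1" by simp_all
    moreover have "d n = (\<not> c)"
      using out \<open>m = q e - 1\<close> d_before[of e] by (simp add: outward_def)
    ultimately show ?thesis using not_inward_after_opposite_run[of n i' e] inward n by simp
  qed
qed

text \<open>The only surviving change goes from \<open>lo e\<close> to \<open>hi e\<close>, still
  inwards, and jumps back from position \<open>q e + b\<close> to \<open>q e\<close>. The others
  prolong a run to \<open>b + 1\<close> arcs.\<close>

lemma inward_Suc:
  assumes inw: "inward n i m" and n: "N + b \<le> n"
  shows "\<exists>i' m'. inward (Suc n) i' m' \<and> m' < m"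
proof (cases rule: stepE[of "Suc n"])
  case (outward i' m')
  then have "R i m = R i' m'" using inw by (simp add: outward_def inward_def)
  then show ?thesis
  proof (cases rule: R_eqE)
    case same
    then show ?thesis using outward inw p_neq[of n] by (simp add: outward_def inward_def)
  next
    case (lo_hi e)
    have "d n = c" using inw lo_hi d_after[of e] by (simp add: inward_def)
    then show ?thesis using not_outward_after_opposite_run[of n i' e] outward lo_hi n by simp
  next
    case (hi_lo e)
    have "d (Suc n) = (\<not> c)" using outward hi_lo d_after[of e] by (simp add: outward_def)
    then show ?thesis using not_continued_after_inward_run[of n i e] inw hi_lo n by simp
  qed
next
  case (inward i' m')
  then have "R i m = R i' (Suc m')" using inw by (simp add: inward_def)
  then show ?thesis
  proof (cases rule: R_eqE)
    case same
    then show ?thesis using inward by blast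
  next
    case (lo_hi e)
    then have "m' < m" by simp
    then show ?thesis using inward by blast
  next
    case (hi_lo e)
    then have "m' = q e + b - 1" by simp
    then have "d (Suc n) = (\<not> c)"
      using inward d_run[of e m'] b_pos by (simp add: inward_def)
    then show ?thesis using not_continued_after_inward_run[of n i e] inw hi_lo n by simp
  qed
qed

text \<open>One late inward step would start an infinite descent of positions.\<close>

lemma not_inward: "N + b \<le> n \<Longrightarrow> \<not> inward n i m"
proof (induction m arbitrary: n i rule: less_induct)
  case (less m)
  then show ?case using inward_Suc[of n i m] by (meson le_Suc_eq)
qed

text \<open>Either the ray stays on \<open>R i\<close> forever, or it drops to a lower level; levels
  cannot drop infinitely often.\<close>

lemma outward_eventually:
  "outward n i m \<Longrightarrow> N + b \<le> n \<Longrightarrow> \<exists>n i m. \<forall>j. outward (n + j) i (m + j)"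
proof (induction "lev i" arbitrary: n i m rule: less_induct)
  case less
  show ?case
  proof (cases "\<forall>j. outward (n + j) i (m + j)")
    case False
    \<comment> \<open>The first departure from \<open>R i\<close>. It is not 0, so the step before
      it is outward on \<open>R i\<close> and \<open>outward_Suc\<close> applies.\<close>
    define j where "j = (LEAST j. \<not> outward (n + j) i (m + j))"
    have j: "\<not> outward (n + j) i (m + j)"
      using False LeastI_ex[of "\<lambda>j. \<not> outward (n + j) i (m + j)"] by (auto simp: j_def)
    then obtain j' where j': "j = Suc j'" using less.prems by (cases j) auto
    then have "outward (n + j') i (m + j')"
      using not_less_Least[of j' "\<lambda>j. \<not> outward (n + j) i (m + j)"] by (auto simp: j_def)
    then obtain i' m' where "outward (n + j) i' m'" "lev i' < lev i"
      using outward_Suc[of "n + j'" i "m + j'"] less.prems j j' by auto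
    then show ?thesis using less.hyps less.prems by (meson trans_le_add1)
  qed blast
qed

lemma eventually_on_ray: "\<exists>i m. \<forall>j\<ge>m. R i j \<in> range p"
proof -
  obtain i m where "outward (N + b) i m"
    using stepE[of "N + b"] not_inward[of "N + b"] by blast
  from outward_eventually[OF this] obtain n i m where "\<forall>j. outward (n + j) i (m + j)"
    by blast
  then have "p (n + (j - m)) = R i j" if "m \<le> j" for j
    using that by (metis outward_def le_add_diff_inverse)
  then show ?thesis by (metis rangeI)
qed

end

section \<open>Disjoint copies in the host\<close>

context junction_host
begin

lemma disjoint_copies_levels:
  assumes "inj v"
  shows "disjoint_copies (ray_digraph d v) host ((\<lambda>i. ray_digraph d (R i)) ` {i. lev i = k})"
  unfolding disjoint_copies_def
proof (intro conjI ballI)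
  fix K assume "K \<in> (\<lambda>i. ray_digraph d (R i)) ` {i. lev i = k}"
  then obtain i where K: "K = ray_digraph d (R i)" by blast
  show "digraph_iso (with_proj (ray_digraph d v)) (with_proj K)"
    unfolding K using assms inj_R by (rule digraph_iso_ray_digraph)
  interpret pair_loopfree_digraph host by (rule host_loopfree)
  show "subgraph (with_proj K) (with_proj host)"
    using wf_ray_digraph[of d "R i"] wf_digraph
    by (auto simp: subgraph_def K compatible_def host_def)
next
  show "pairwise (\<lambda>K L. disjnt (pverts K) (pverts L)) ((\<lambda>i. ray_digraph d (R i)) ` {i. lev i = k})"
    by (auto simp: pairwise_def disjnt_def dest: R_eq_same_level)
qed

lemma not_ubiquitous:
  assumes "inj v"
  shows "\<not> ubiquitous TYPE('a) (ray_digraph d v)"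
proof
  assume "ubiquitous TYPE('a) (ray_digraph d v)"
  moreover have "\<exists>F. disjoint_copies (ray_digraph d v) host F \<and> finite F \<and> card F = k" for k
  proof -
    obtain I where I: "I \<subseteq> {i. lev i = k}" "card I = k" "finite I"
      using card_lev[of k] by (rule obtain_subset_with_card_n)
    have inj: "inj (\<lambda>i. ray_digraph d (R i))"
    proof (rule injI)
      fix i j assume eq: "ray_digraph d (R i) = ray_digraph d (R j)"
      \<comment> \<open>Position 0 precedes every junction, so the first vertex of
        \<open>R i\<close> lies on no other given ray.\<close>
      have "\<not> junction i 0"
        using b_pos by (auto simp: junction_def intro: le_less_trans[OF _ N_less_q])
      moreover have "R i 0 \<in> range (R j)" using arg_cong[OF eq, of pverts] by auto
      ultimately show "i = j" using R_eq_nonjunction by blast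
    qed
    have "disjoint_copies (ray_digraph d v) host ((\<lambda>i. ray_digraph d (R i)) ` I)"
      using disjoint_copies_levels[OF assms, of k] I(1)
      unfolding disjoint_copies_def by (meson image_mono pairwise_subset subsetD)
    moreover have "card ((\<lambda>i. ray_digraph d (R i)) ` I) = k"
      using inj I(2) by (metis card_image inj_on_subset subset_UNIV)
    ultimately show ?thesis using I(3) by blast
  qed
  ultimately obtain F where F: "disjoint_copies (ray_digraph d v) host F" "infinite F"
    using host_loopfree unfolding ubiquitous_def by blast
  have "\<exists>i m. \<forall>j\<ge>m. R i j \<in> pverts K" if "K \<in> F" for K
  proof -
    have sub: "subgraph (with_proj K) (with_proj host)"
      and iso: "digraph_iso (with_proj (ray_digraph d v)) (with_proj K)"
      using F(1) that by (auto simp: disjoint_copies_def)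
    obtain w where w: "inj w" "K = ray_digraph d w"
      using digraph_iso_ray_digraphD[OF iso assms] .
    interpret ray_in_host d b N c q lo hi lev J g w
      using sub w by unfold_locales (auto simp: subgraph_def)
    show ?thesis using eventually_on_ray w(2) by simp
  qed
  \<comment> \<open>The copy \<open>K\<close> contains the given ray \<open>\<iota> K\<close> from
    position \<open>\<mu> K\<close> on.\<close>
  then obtain \<iota> \<mu> where tail: "\<And>K j. K \<in> F \<Longrightarrow> \<mu> K \<le> j \<Longrightarrow> R (\<iota> K) j \<in> pverts K"
    by metis
  have disj: "K = L" if "K \<in> F" "L \<in> F" "x \<in> pverts K" "x \<in> pverts L" for K L x
    using F(1) that unfolding disjoint_copies_def pairwise_def disjnt_def by blast
  have inj: "inj_on \<iota> F"
  proof (rule inj_onI)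
    fix K L assume "K \<in> F" "L \<in> F" "\<iota> K = \<iota> L"
    then show "K = L" using disj[of K L] tail[of K "max (\<mu> K) (\<mu> L)"] tail[of L "max (\<mu> K) (\<mu> L)"]
      by simp
  qed
  have not_less: "\<not> lev (\<iota> K) < lev (\<iota> L)" if KL: "K \<in> F" "L \<in> F" for K L
  proof
    assume less: "lev (\<iota> K) < lev (\<iota> L)"
    \<comment> \<open>A junction of the two rays beyond both thresholds is a common vertex of
      \<open>K\<close> and \<open>L\<close>.\<close>
    then obtain e where e: "max (\<mu> K) (\<mu> L) \<le> e" "J e" "lo e = \<iota> K" "hi e = \<iota> L"
      using recurrent by blast
    have "e \<le> q e" using strict_mono_q by (rule strict_mono_imp_increasing)
    then have "R (\<iota> K) (q e + b) \<in> pverts K" "R (\<iota> L) (q e) \<in> pverts L"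
      using KL tail e(1) by auto
    then have "K = L" using disj KL R_junction[OF e(2)] e by metis
    then show False using less by simp
  qed
  obtain K where "K \<in> F" using F(2) by fastforce
  then have "\<iota> ` F \<subseteq> {i. lev i = lev (\<iota> K)}"
    using not_less by (auto intro: linorder_neqE_nat)
  then have "finite (\<iota> ` F)" using finite_lev finite_subset by blast
  then show False using inj F(2) finite_image_iff by blast
qed

end

section \<open>Choice of the run length and of the junctions\<close>

lemma exists_junction_host:
  assumes bounded: "\<And>n L k. (\<And>j. j < L \<Longrightarrow> d (n + j) = k) \<Longrightarrow> L \<le> B"
    and inf: "infinite (UNIV :: 'a set)"
  shows "\<exists>b N c q lo hi lev J (g :: nat \<times> nat \<Rightarrow> 'a). junction_host d b N c q lo hi lev J g"
proof -
  define runs where "runs L k = {n. \<forall>j<L. d (n + j) = k}" for L k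
  \<comment> \<open>Members of \<open>runs\<close> start constant blocks that need not be maximal.
    The greatest \<open>L\<close> exists, since \<open>L = 0\<close> qualifies and \<open>B\<close>
    bounds all candidates.\<close>
  define b where "b = (GREATEST L. infinite (runs L True \<union> runs L False))"
  have bound: "L \<le> B" if inf_runs: "infinite (runs L True \<union> runs L False)" for L
  proof -
    obtain n where "n \<in> runs L True \<union> runs L False"
      using inf_runs by (metis finite.emptyI ex_in_conv)
    then show ?thesis using bounded unfolding runs_def by blast
  qed
  have zero: "infinite (runs 0 True \<union> runs 0 False)" by (simp add: runs_def)
  have b: "infinite (runs b True \<union> runs b False)"
    unfolding b_def
    by (rule GreatestI_nat[where P = "\<lambda>L. infinite (runs L True \<union> runs L False)", OF zero bound])
  have greatest: "L \<le> b" if "infinite (runs L True \<union> runs L False)" for L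
    unfolding b_def
    by (rule Greatest_le_nat[where P = "\<lambda>L. infinite (runs L True \<union> runs L False)", OF that bound])
  obtain c where c: "infinite (runs b c)" using b by auto
  have "finite (runs (Suc b) True \<union> runs (Suc b) False)" using greatest by fastforce
  then obtain N where N: "\<forall>n \<in> runs (Suc b) True \<union> runs (Suc b) False. n < N"
    unfolding finite_nat_set_iff_bounded ..
  have no_run: False if "N \<le> n" "\<And>j. j \<le> b \<Longrightarrow> d (n + j) = x" for n x
  proof -
    have "n \<in> runs (Suc b) x" using that by (auto simp: runs_def)
    then have "n < N" using N by (cases x) auto
    then show False using that(1) by simp
  qed
  have large: "\<exists>m. m \<in> runs b c \<and> n < m" for n
    using c unfolding infinite_nat_iff_unbounded by blast
  have "\<exists>q. \<forall>e. (q e \<in> runs b c \<and> N < q e) \<and> q e + b < q (Suc e)"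
  proof (rule dependent_nat_choice)
    show "\<exists>m. m \<in> runs b c \<and> N < m" by (rule large)
    show "\<exists>m'. (m' \<in> runs b c \<and> N < m') \<and> m + b < m'" if "m \<in> runs b c \<and> N < m" for m :: nat
    proof -
      obtain m' where "m' \<in> runs b c" "m + b < m'" using large by blast
      then show ?thesis using that by (intro exI[of _ m']) simp
    qed
  qed
  then obtain q where q: "\<And>e. q e \<in> runs b c" "\<And>e. N < q e" "\<And>e. q e + b < q (Suc e)"
    by blast
  \<comment> \<open>Level \<open>k\<close> is an antidiagonal under the pairing code, with
    \<open>k + 1\<close> members. A junction index \<open>e\<close> codes a pair of rays together
    with a counter, so every pair recurs beyond any bound.\<close>
  define lev where "lev n = fst (prod_decode n) + snd (prod_decode n)" for n
  define lo where "lo e = fst (prod_decode (fst (prod_decode e)))" for e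
  define hi where "hi e = snd (prod_decode (fst (prod_decode e)))" for e
  have lev: "{i. lev i = k} = (\<lambda>x. prod_encode (x, k - x)) ` {..k}" for k
  proof (intro equalityI subsetI)
    fix i assume "i \<in> {i. lev i = k}"
    then have "i = prod_encode (fst (prod_decode i), k - fst (prod_decode i))"
      "fst (prod_decode i) \<le> k" by (auto simp: lev_def)
    then show "i \<in> (\<lambda>x. prod_encode (x, k - x)) ` {..k}" by blast
  qed (auto simp: lev_def)
  have card_lev: "card {i. lev i = k} = Suc k" for k
    unfolding lev by (subst card_image) (auto simp: inj_on_def)
  have recurrent: "\<exists>e\<ge>t. lev (lo e) < lev (hi e) \<and> lo e = i \<and> hi e = j" if "lev i < lev j" for i j t
    using that by (intro exI[of _ "prod_encode (prod_encode (i, j), t)"])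
      (simp add: lo_def hi_def le_prod_encode_2)
  obtain f :: "nat \<Rightarrow> 'a" where "inj f" using infinite_countable_subset[OF inf] by blast
  then have "inj (f \<circ> prod_encode)" by (simp add: inj_compose inj_prod_encode)
  then have "junction_host d b N c q lo hi lev (\<lambda>e. lev (lo e) < lev (hi e)) (f \<circ> prod_encode)"
    using no_run q recurrent card_lev lev
    by unfold_locales (auto simp: runs_def)
  then show ?thesis by blast
qed

section \<open>Phases and runs\<close>

lemma pawalk_verts_map_upt:
  "pawalk_verts (w m) (map (\<lambda>i. (w i, w (Suc i))) [m..<m + L]) = map w [m..<Suc (m + L)]"
proof (induction L arbitrary: m)
  case (Suc L)
  then show ?case using Suc.IH[of "Suc m"] by (simp add: upt_conv_Cons del: upt_Suc)
qed simp

lemma pcas_map_upt: "pcas (w m) (map (\<lambda>i. (w i, w (Suc i))) [m..<m + L]) (w (m + L))"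
proof (induction L arbitrary: m)
  case (Suc L)
  then show ?case using Suc.IH[of "Suc m"] by (simp add: upt_conv_Cons del: upt_Suc)
qed simp

lemma dipath_of_inj_on:
  assumes "inj_on w {..L}"
  shows "dipath (with_proj \<lparr>pverts = w ` {..L}, parcs = (\<lambda>i. (w i, w (Suc i))) ` {..<L}\<rparr>)"
    (is "dipath (with_proj ?K)")
proof -
  let ?p = "map (\<lambda>i. (w i, w (Suc i))) [0..<L]"
  have verts: "pawalk_verts (w 0) ?p = map w [0..<Suc L]"
    using pawalk_verts_map_upt[of w 0 L] by simp
  have "pcas (w 0) ?p (w L)" using pcas_map_upt[of w 0 L] by simp
  moreover have "distinct (map w [0..<Suc L])"
    using assms by (simp add: distinct_map atLeast0_lessThan_Suc lessThan_Suc_atMost atLeast0LessThan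
        del: upt_Suc)
  ultimately have "pre_digraph.apath (with_proj ?K) (w 0) ?p (w L)"
    by (auto simp: pre_digraph.apath_def pre_digraph.awalk_def cas_with_proj_eq
        awalk_verts_with_proj_eq verts simp del: upt_Suc)
  moreover have "set (map w [0..<Suc L]) = w ` {..L}"
    by (simp add: lessThan_Suc_atMost atLeast0LessThan del: upt_Suc)
  ultimately show ?thesis
    unfolding dipath_def
    by (intro exI[of _ "w 0"] exI[of _ ?p] exI[of _ "w L"])
      (simp add: awalk_verts_with_proj_eq verts atLeast0LessThan del: upt_Suc)
qed

section \<open>Walks confined to closed vertex sets\<close>

lemma pcas_closed:
  assumes "pcas x p y" "set p \<subseteq> E" "x \<in> A" "\<And>a. a \<in> E \<Longrightarrow> fst a \<in> A \<Longrightarrow> snd a \<in> A"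
  shows "set (pawalk_verts x p) \<subseteq> A"
  using assms by (induction p arbitrary: x) auto

lemma pcas_closed_rev:
  assumes "pcas x p y" "set p \<subseteq> E" "y \<in> A" "\<And>a. a \<in> E \<Longrightarrow> snd a \<in> A \<Longrightarrow> fst a \<in> A"
  shows "set (pawalk_verts x p) \<subseteq> A \<and> x \<in> A"
  using assms by (induction p arbitrary: x) auto

lemma pawalk_verts_ends:
  "pcas x p y \<Longrightarrow> x \<in> set (pawalk_verts x p) \<and> y \<in> set (pawalk_verts x p)"
  by (induction p arbitrary: x) auto

lemma pawalk_verts_arc_ends:
  "pcas x p y \<Longrightarrow> a \<in> set p
    \<Longrightarrow> fst a \<in> set (pawalk_verts x p) \<and> snd a \<in> set (pawalk_verts x p)"
  by (induction p arbitrary: x) (auto dest: pawalk_verts_ends)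

text \<open>At the first change of orientation \<open>M\<close> after \<open>n\<close>, the vertex \<open>v M\<close> is a source or a sink, so a
  dipath through the arc \<open>n\<close> cannot cross it.\<close>

lemma dipath_below_change:
  assumes v: "inj v"
    and change: "n < M" "d M \<noteq> d n" "\<And>j. n \<le> j \<Longrightarrow> j < M \<Longrightarrow> d j = d n"
    and K: "subgraph K (with_proj (ray_digraph d v))" "dipath K" "ray_arc d v n \<in> arcs K"
  shows "verts K \<subseteq> v ` {..M}"
proof -
  obtain x p y where path: "pre_digraph.apath K x p y"
    and verts: "verts K = set (pre_digraph.awalk_verts K x p)" and arcs: "arcs K = set p"
    using K(2) by (auto simp: dipath_def)
  \<comment> \<open>Compatibility fixes tail and head as \<open>fst\<close> and \<open>snd\<close>,
    so the walk notions for pair digraphs apply to \<open>K\<close>.\<close>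
  have "K = with_proj \<lparr>pverts = verts K, parcs = arcs K\<rparr>"
    using K(1) by (auto simp: subgraph_def compatible_def with_proj_def intro!: pre_digraph.equality)
  then have eqs: "pre_digraph.cas K = pcas" "pre_digraph.awalk_verts K = pawalk_verts"
    by (metis cas_with_proj_eq, metis awalk_verts_with_proj_eq)
  have p: "pcas x p y" using path by (simp add: pre_digraph.apath_def pre_digraph.awalk_def eqs)
  have E: "set p \<subseteq> range (ray_arc d v)" using K(1) arcs by (simp add: subgraph_def)
  have verts: "verts K = set (pawalk_verts x p)" using verts by (simp add: eqs)
  have range: "verts K \<subseteq> range v" using K(1) by (simp add: subgraph_def)
  have mem [simp]: "v j \<in> v ` A \<longleftrightarrow> j \<in> A" for j A using v by (rule inj_image_mem_iff)
  have vn: "v n \<in> verts K"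
    using pawalk_verts_arc_ends[OF p] K(3) unfolding arcs verts
    by (fastforce simp: ray_arc_def split: if_splits)
  have prev: "d j = d n" if "M = Suc j" for j using change(1) that by (intro change(3)) auto
  obtain s t where s: "x = v s" and t: "y = v t"
    using pawalk_verts_ends[OF p] range verts by blast
  show ?thesis
  proof (cases "d n")
    case True
    \<comment> \<open>Here \<open>v M\<close> is a sink. No arc leaves either side of it, so the
      side of the first vertex \<open>x\<close> decides.\<close>
    have low: "snd a \<in> v ` {..M}" if "a \<in> range (ray_arc d v)" "fst a \<in> v ` {..M}" for a
    proof -
      from that(1) obtain j where "a = ray_arc d v j" by blast
      then show ?thesis
        using that(2) change(1,2) True by (cases "j = M") (auto simp: ray_arc_def split: if_splits)
    qed
    have high: "snd a \<in> v ` {M..}" if "a \<in> range (ray_arc d v)" "fst a \<in> v ` {M..}" for a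
    proof -
      from that(1) obtain j where "a = ray_arc d v j" by blast
      then show ?thesis
        using that(2) prev[of j] True by (cases "M = Suc j") (auto simp: ray_arc_def split: if_splits)
    qed
    show ?thesis
    proof (cases "s \<le> M")
      case True
      then show ?thesis using pcas_closed[OF p E _ low] s verts by simp
    next
      case False
      then have "v n \<in> v ` {M..}" using pcas_closed[OF p E _ high] s verts vn by fastforce
      then show ?thesis using change(1) by simp
    qed
  next
    case False
    \<comment> \<open>Here \<open>v M\<close> is a source. Both sides are closed against the arcs,
      so the last vertex \<open>y\<close> decides.\<close>
    have low: "fst a \<in> v ` {..M}" if "a \<in> range (ray_arc d v)" "snd a \<in> v ` {..M}" for a
    proof -
      from that(1) obtain j where "a = ray_arc d v j" by blast
      then show ?thesis
        using that(2) change(1,2) False by (cases "j = M") (auto simp: ray_arc_def split: if_splits)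
    qed
    have high: "fst a \<in> v ` {M..}" if "a \<in> range (ray_arc d v)" "snd a \<in> v ` {M..}" for a
    proof -
      from that(1) obtain j where "a = ray_arc d v j" by blast
      then show ?thesis
        using that(2) prev[of j] False by (cases "M = Suc j") (auto simp: ray_arc_def split: if_splits)
    qed
    show ?thesis
    proof (cases "t \<le> M")
      case True
      then show ?thesis using pcas_closed_rev[OF p E _ low] t verts by simp
    next
      case False
      then have "v n \<in> v ` {M..}" using pcas_closed_rev[OF p E _ high] t verts vn by fastforce
      then show ?thesis using change(1) by simp
    qed
  qed
qed

text \<open>This transfers a bound on phase lengths to runs. A run is a dipath, and the next change
  of orientation confines all dipaths containing it to finitely many vertices, so a largest one
  exists and is a phase.\<close>

lemma run_in_phase:
  assumes v: "inj v"
    and inf: "infinite {n. d n}" "infinite {n. \<not> d n}"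
    and run: "\<And>j. j < L \<Longrightarrow> d (n + j) = k" and "0 < L"
  shows "\<exists>P \<in> phases (ray_digraph d v). L \<le> card (arcs P)"
proof -
  let ?H = "with_proj (ray_digraph d v)"
  \<comment> \<open>For \<open>k = False\<close> the arcs point inwards, so the dipath is listed
    from its far end.\<close>
  define w where "w i = (if k then v (n + i) else v (n + L - i))" for i
  define K0 where "K0 = \<lparr>pverts = w ` {..L}, parcs = (\<lambda>i. (w i, w (Suc i))) ` {..<L}\<rparr>"
  have inj_w: "inj_on w {..L}"
    using v by (cases k) (auto simp: w_def inj_eq intro!: inj_onI)
  have dipath0: "dipath (with_proj K0)" unfolding K0_def by (rule dipath_of_inj_on[OF inj_w])
  have "(w i, w (Suc i)) = ray_arc d v (if k then n + i else n + (L - Suc i))" if "i < L" for i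
    using that run[of i] run[of "L - Suc i"] by (auto simp: w_def ray_arc_def Suc_diff_Suc)
  then have arcs0: "parcs K0 \<subseteq> range (ray_arc d v)" by (auto simp: K0_def)
  have "ray_arc d v n = (if k then (w 0, w (Suc 0)) else (w (L - 1), w (Suc (L - 1))))"
    using run[of 0] \<open>0 < L\<close> by (auto simp: w_def ray_arc_def)
  then have arc_n: "ray_arc d v n \<in> parcs K0" using \<open>0 < L\<close> by (auto simp: K0_def)
  have card0: "card (parcs K0) = L"
  proof -
    have "inj_on (\<lambda>i. (w i, w (Suc i))) {..<L}" using inj_w by (auto simp: inj_on_def)
    then show ?thesis by (simp add: K0_def card_image)
  qed
  have wf0: "wf_digraph (with_proj K0)"
    by unfold_locales (auto simp: K0_def)
  have sub0: "subgraph (with_proj K0) ?H"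
    using arcs0 wf0 wf_ray_digraph by (auto simp: subgraph_def compatible_def K0_def w_def)
  have "\<exists>M>n. d M \<noteq> d n"
  proof -
    have "infinite {m. d m \<noteq> d n}" using inf by (cases "d n") auto
    then show ?thesis unfolding infinite_nat_iff_unbounded by blast
  qed
  then obtain M where M: "n < M" "d M \<noteq> d n" and least: "\<And>j. j < M \<Longrightarrow> \<not> (n < j \<and> d j \<noteq> d n)"
    using exists_least_iff[of "\<lambda>M. n < M \<and> d M \<noteq> d n"] by blast
  have change: "d j = d n" if "n \<le> j" "j < M" for j
    using least[of j] that by (cases "j = n") auto
  define V where "V = v ` {..M}"
  have fin: "finite V" by (simp add: V_def)
  define S where "S K \<longleftrightarrow> subgraph K ?H \<and> dipath K \<and> subgraph (with_proj K0) K" for K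
  \<comment> \<open>With vertices and arcs both counted, a larger dipath of the same size must
    coincide with \<open>K\<close>.\<close>
  define size where "size K = card (verts K) + card (arcs K)" for K :: "('a, 'a \<times> 'a) pre_digraph"
  have bound: "verts K \<subseteq> V \<and> arcs K \<subseteq> V \<times> V" if "S K" for K
  proof -
    have "ray_arc d v n \<in> arcs K" using arc_n that by (auto simp: S_def subgraph_def)
    then have V: "verts K \<subseteq> V"
      using dipath_below_change[OF v M change] that unfolding S_def V_def by blast
    have "fst a \<in> verts K \<and> snd a \<in> verts K" if "a \<in> arcs K" for a
      using \<open>S K\<close> that unfolding S_def subgraph_def compatible_def
      by (metis wf_digraph.head_in_verts wf_digraph.tail_in_verts with_proj_simps(4,5))
    then show ?thesis using V by auto
  qed
  have finK: "finite (verts K)" "finite (arcs K)" if "S K" for K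
    using bound[OF that] fin by (meson finite_SigmaI finite_subset)+
  have "S (with_proj K0)"
    using sub0 dipath0 wf0 by (simp add: S_def subgraph_def compatible_def)
  moreover have "\<forall>K. S K \<longrightarrow> size K < Suc (card V + card (V \<times> V))"
    unfolding size_def less_Suc_eq_le using bound fin by (intro allI impI add_mono card_mono) auto
  ultimately have "\<exists>K. S K \<and> (\<forall>K'. S K' \<longrightarrow> size K' \<le> size K)"
    by (rule Lattices_Big.ex_has_greatest_nat)
  then obtain K where K: "S K" "\<And>K'. S K' \<Longrightarrow> size K' \<le> size K" by blast
  have "K' = K" if sub: "subgraph K K'" "subgraph K' ?H" "dipath K'" for K'
  proof -
    have S': "S K'"
      using that K(1) unfolding S_def by (auto simp: subgraph_def compatible_def)
    have le: "verts K \<subseteq> verts K'" "arcs K \<subseteq> arcs K'" using sub by (auto simp: subgraph_def)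
    then have "card (verts K) \<le> card (verts K')" "card (arcs K) \<le> card (arcs K')"
      using finK[OF S'] by (auto intro: card_mono)
    then have "card (verts K) = card (verts K')" "card (arcs K) = card (arcs K')"
      using K(2)[OF S'] by (auto simp: size_def)
    then have "verts K = verts K'" "arcs K = arcs K'"
      using le finK[OF S'] by (metis card_subset_eq)+
    then show ?thesis
      using sub(1) by (auto simp: subgraph_def compatible_def intro!: pre_digraph.equality)
  qed
  then have "K \<in> phases (ray_digraph d v)"
    using K(1) by (auto simp: phases_def pre_digraph.max_subgraph_def S_def)
  moreover have "L \<le> card (arcs K)"
  proof -
    have "parcs K0 \<subseteq> arcs K" using K(1) by (auto simp: S_def subgraph_def)
    then show ?thesis using card0 finK(2)[OF K(1)] card_mono by metis
  qed
  ultimately show ?thesis by blast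
qed

section \<open>Non-ubiquity\<close>

text \<open>The first vertex is determined by its degree: if \<open>w 0 = v k\<close> with
  \<open>k > 0\<close>, both neighbours of \<open>v k\<close> would equal \<open>w 1\<close>. The
  rest follows edge by edge.\<close>

lemma ray_enumeration_unique:
  assumes "ray_enumeration H v" "ray_enumeration H w"
  shows "w = v"
proof -
  have v: "inj v" "range v = pverts H" and w: "inj w" "range w = pverts H"
    and E: "range (\<lambda>n. {v n, v (Suc n)}) = range (\<lambda>n. {w n, w (Suc n)})"
    using assms by (auto simp: ray_enumeration_def bij_betw_def)
  have edge: "\<exists>m. {v n, v (Suc n)} = {w m, w (Suc m)}" for n
    using E by (metis (mono_tags, lifting) rangeE rangeI)
  obtain k where k: "w 0 = v k" using v(2) w(2) by (metis rangeE rangeI)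
  have "k = 0"
  proof (rule ccontr)
    assume "k \<noteq> 0"
    then obtain k' where k': "k = Suc k'" by (cases k) auto
    have "v k' = w 1"
      using edge[of k'] k k' v(1) w(1) by (auto simp: doubleton_eq_iff inj_eq)
    moreover have "v (Suc k) = w 1"
      using edge[of k] k v(1) w(1) by (auto simp: doubleton_eq_iff inj_eq)
    ultimately have "v k' = v (Suc k)" by simp
    then show False using k' v(1) by (simp add: inj_eq)
  qed
  have "w n = v n \<and> w (Suc n) = v (Suc n)" for n
  proof (induction n)
    case 0
    show ?case
      using edge[of 0] k \<open>k = 0\<close> v(1) w(1) by (auto simp: doubleton_eq_iff inj_eq)
  next
    case (Suc n)
    obtain m where m: "{v (Suc n), v (Suc (Suc n))} = {w m, w (Suc m)}" using edge by blast
    then have "w (Suc n) = w m \<or> w (Suc n) = w (Suc m)" using Suc by auto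
    then have "m = Suc n \<or> m = n" using w(1) by (auto simp: inj_eq)
    then show ?case using m Suc v(1) by (auto simp: doubleton_eq_iff inj_eq)
  qed
  then show ?thesis by blast
qed

text \<open>By asymmetry each edge carries exactly one arc, so testing for the outward arc
  determines the orientation.\<close>

lemma oriented_ray_eq_ray_digraph:
  assumes "oriented_ray H" "ray_enumeration H v"
  shows "H = ray_digraph (\<lambda>n. (v n, v (Suc n)) \<in> parcs H) v" (is "H = ray_digraph ?d v")
proof -
  have asym: "(y, x) \<notin> parcs H" if "(x, y) \<in> parcs H" for x y
    using assms(1) that by (auto simp: oriented_ray_def asym_on_def)
  have E: "(\<lambda>(x, y). {x, y}) ` parcs H = range (\<lambda>n. {v n, v (Suc n)})"
    using assms(2) by (simp add: ray_enumeration_def underlying_edges_def)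
  have "parcs H = range (ray_arc ?d v)"
  proof (intro equalityI subsetI)
    fix a assume a: "a \<in> parcs H"
    then obtain n where "{fst a, snd a} = {v n, v (Suc n)}"
      using E imageI[OF a, of "\<lambda>(x, y). {x, y}"] by (auto simp: case_prod_unfold)
    then have "a = ray_arc ?d v n"
      using a asym by (cases a) (auto simp: ray_arc_def doubleton_eq_iff)
    then show "a \<in> range (ray_arc ?d v)" by blast
  next
    fix a assume "a \<in> range (ray_arc ?d v)"
    then obtain n where n: "a = ray_arc ?d v n" by blast
    have "{v n, v (Suc n)} \<in> (\<lambda>(x, y). {x, y}) ` parcs H" unfolding E by blast
    then show "a \<in> parcs H" by (auto simp: n ray_arc_def doubleton_eq_iff)
  qed
  moreover have "pverts H = range v"
    using assms(2) by (simp add: ray_enumeration_def bij_betw_def)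
  ultimately show ?thesis by (simp add: ray_digraph_def)
qed

theorem theorem4p2:
  fixes H :: "'a pair_pre_digraph" and s :: "nat \<Rightarrow> nat"
  assumes "oriented_ray H"
    and "infinite (in_oriented_arcs H)"
    and "infinite (out_oriented_arcs H)"
    and "representing_sequence H s"
    and "bounded_sequence s"
    and "infinite (UNIV :: 'b set)"
  shows "\<not> ubiquitous TYPE('b) H"
proof -
  obtain v where v: "ray_enumeration H v" using assms(1) by (auto simp: oriented_ray_def)
  then have inj: "inj v" by (simp add: ray_enumeration_def bij_betw_def)
  define d where "d n \<longleftrightarrow> (v n, v (Suc n)) \<in> parcs H" for n
  have H: "H = ray_digraph d v"
    using oriented_ray_eq_ray_digraph[OF assms(1) v] by (simp add: d_def[abs_def])
  have arcs: "parcs H = range (ray_arc d v)" by (subst H) simp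
  \<comment> \<open>\<open>in_oriented_arcs\<close> admits any enumeration; uniqueness reduces it to
    \<open>v\<close>.\<close>
  have "in_oriented_arcs H \<subseteq> ray_arc d v ` {n. \<not> d n}"
  proof
    fix a assume "a \<in> in_oriented_arcs H"
    then obtain n where a: "a \<in> parcs H" "a = (v (Suc n), v n)"
      using ray_enumeration_unique[OF v] by (auto simp: in_oriented_arcs_def)
    then have "\<not> d n"
      using assms(1) by (auto simp: d_def oriented_ray_def asym_on_def)
    then show "a \<in> ray_arc d v ` {n. \<not> d n}" using a by (auto simp: ray_arc_def)
  qed
  then have inf_in: "infinite {n. \<not> d n}"
    using assms(2) finite_surj by blast
  have "out_oriented_arcs H \<subseteq> ray_arc d v ` {n. d n}"
  proof
    fix a assume a: "a \<in> out_oriented_arcs H"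
    then obtain n where n: "a = ray_arc d v n" using arcs by (auto simp: out_oriented_arcs_def)
    have "d n"
      using a v unfolding n ray_arc_def out_oriented_arcs_def in_oriented_arcs_def
      by (cases "d n") auto
    then show "a \<in> ray_arc d v ` {n. d n}" using n by blast
  qed
  then have inf_out: "infinite {n. d n}"
    using assms(3) finite_surj by blast
  obtain P where P: "bij_betw P UNIV (phases H)" "\<And>n. s n = card (arcs (P n))"
    using assms(4) by (auto simp: representing_sequence_def)
  obtain B where B: "\<And>n. s n \<le> B" using assms(5) by (auto simp: bounded_sequence_def)
  \<comment> \<open>\<open>P\<close> reaches every phase, so \<open>B\<close> bounds all phase
    lengths and hence all runs.\<close>
  have "L \<le> B" if "\<And>j. j < L \<Longrightarrow> d (n + j) = k" for n L k
  proof (cases "L = 0")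
    case False
    then have "\<exists>Q \<in> phases H. L \<le> card (arcs Q)"
      unfolding H using run_in_phase[OF inj inf_out inf_in] that by blast
    then obtain Q where "Q \<in> phases H" "L \<le> card (arcs Q)" by blast
    then show ?thesis using P B by (metis bij_betw_imp_surj_on le_trans rangeE)
  qed simp
  then obtain b N c q lo hi lev J and g :: "nat \<times> nat \<Rightarrow> 'b"
    where "junction_host d b N c q lo hi lev J g"
    using exists_junction_host[of d B, OF _ assms(6)] by blast
  then show ?thesis unfolding H using junction_host.not_ubiquitous[OF _ inj] by blast
qed

end
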